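(* We have $h_{OD}(A_{625})\geq 6$. In particular, there is a finite simple group (namely $A_{625}$) which is $k$-fold OD-characterizable for some $k\geq 3$, and it is not true that all alternating groups $A_m$ with $m\neq 10$ are OD-characterizable.
   Context: All groups are finite. $A_n$ denotes the alternating group of degree $n$. For a finite group $G$, $\pi(G)$ is the set of prime divisors of $|G|$. The prime graph $GK(G)$ is the graph with vertex set $\pi(G)$ in which two distinct primes $r,s\in\pi(G)$ are adjacent if and only if $G$ contains an element of order $rs$. Writing $\pi(G)=\{p_1,\ldots,p_k\}$ with $p_1<p_2<\cdots<p_k$, the degree pattern of $G$ is the tuple $D(G)=(\deg(p_1),\deg(p_2),\ldots,\deg(p_k))$, where $\deg(p_i)$ is the degree of the vertex $p_i$ in $GK(G)$. For a finite group $G$, $h_{OD}(G)$ denotes the number of pairwise nonisomorphic finite groups $H$ (i.e. the number of isomorphism classes, including that of $G$ itself) such that $|H|=|G|$ and $D(H)=D(G)$. The group $G$ is called $k$-fold OD-characterizable if $h_{OD}(G)=k$, and OD-characterizable if $h_{OD}(G)=1$. *)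

theory Defs
  imports "HOL-Algebra.SimpleGroups" "HOL-Algebra.Sym_Groups" "HOL-Algebra.Multiplicative_Group"
begin

definition prime_divisors :: "('a, 'b) monoid_scheme \<Rightarrow> nat set" where
  "prime_divisors G = {p. Factorial_Ring.prime p \<and> p dvd order G}"

text \<open>The prime graph (Gruenberg--Kegel graph) has vertex set \<^term>\<open>prime_divisors G\<close> and
  the following adjacency relation.\<close>

definition GK_adj :: "('a, 'b) monoid_scheme \<Rightarrow> nat \<Rightarrow> nat \<Rightarrow> bool" where
  "GK_adj G r s \<longleftrightarrow> r \<in> prime_divisors G \<and> s \<in> prime_divisors G \<and> r \<noteq> s \<and>
     (\<exists>x\<in>carrier G. group.ord G x = r * s)"

definition GK_degree :: "('a, 'b) monoid_scheme \<Rightarrow> nat \<Rightarrow> nat" where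
  "GK_degree G p = card {q. GK_adj G p q}"

definition degree_pattern :: "('a, 'b) monoid_scheme \<Rightarrow> nat list" where
  "degree_pattern G = map (GK_degree G) (sorted_list_of_set (prime_divisors G))"

text \<open>Isomorphism classes are counted among groups whose carrier is a set of natural numbers.
  Nothing is lost: every finite group \<^term>\<open>G\<close> has a copy there, which lies in
  \<open>OD_groups G\<close> (see \<open>OD_groups_complete\<close>), and the number of classes is finite
  (see \<open>finite_OD_classes\<close>), so \<^const>\<open>card\<close> is the actual count.\<close>

definition OD_groups :: "('a, 'b) monoid_scheme \<Rightarrow> nat monoid set" where
  "OD_groups G = {H. group H \<and> finite (carrier H) \<and> order H = order G \<and>
     degree_pattern H = degree_pattern G}"

definition OD_classes :: "('a, 'b) monoid_scheme \<Rightarrow> nat monoid set set" where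
  "OD_classes G = OD_groups G // {(H, K). H \<in> OD_groups G \<and> K \<in> OD_groups G \<and> H \<cong> K}"

definition h_OD :: "('a, 'b) monoid_scheme \<Rightarrow> nat" where
  "h_OD G = card (OD_classes G)"

definition fold_OD_characterizable :: "nat \<Rightarrow> ('a, 'b) monoid_scheme \<Rightarrow> bool" where
  "fold_OD_characterizable k G \<longleftrightarrow> h_OD G = k"

definition OD_characterizable :: "('a, 'b) monoid_scheme \<Rightarrow> bool" where
  "OD_characterizable G \<longleftrightarrow> h_OD G = 1"

lemma equiv_OD:
  "equiv (OD_groups G) {(H, K). H \<in> OD_groups G \<and> K \<in> OD_groups G \<and> H \<cong> K}"
proof (rule equivI)
  show "refl_on (OD_groups G) {(H, K). H \<in> OD_groups G \<and> K \<in> OD_groups G \<and> H \<cong> K}"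
    by (auto simp: refl_on_def)
  show "sym {(H, K). H \<in> OD_groups G \<and> K \<in> OD_groups G \<and> H \<cong> K}"
    by (auto simp: sym_def OD_groups_def intro: group.iso_sym)
  show "trans {(H, K). H \<in> OD_groups G \<and> K \<in> OD_groups G \<and> H \<cong> K}"
    by (auto simp: trans_def intro: iso_trans)
qed auto

lemma iso_ord_eq:
  assumes "group G" "group H" "f \<in> iso G H" "x \<in> carrier G"
  shows "group.ord H (f x) = group.ord G x"
proof -
  interpret G: group G by fact
  interpret H: group H by fact
  have hom: "f \<in> hom G H" and inj: "inj_on f (carrier G)"
    using assms by (auto simp: iso_def bij_betw_def)
  interpret f: group_hom G H f
    by unfold_locales (fact hom)
  have "(f x [^]\<^bsub>H\<^esub> n = \<one>\<^bsub>H\<^esub>) = (x [^]\<^bsub>G\<^esub> n = \<one>\<^bsub>G\<^esub>)" for n :: nat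
    using inj assms(4) f.hom_nat_pow[of x n] f.hom_one
    by (metis G.nat_pow_closed G.one_closed inj_on_eq_iff)
  then show ?thesis
    by (simp add: G.ord_def H.ord_def)
qed

lemma iso_degree_pattern:
  assumes "group G" "group H" "G \<cong> H"
  shows "degree_pattern H = degree_pattern G"
proof -
  obtain f where f: "f \<in> iso G H"
    using assms(3) by (auto simp: is_iso_def)
  then have im: "f ` carrier G = carrier H"
    by (auto simp: iso_def bij_betw_def)
  have pi: "prime_divisors H = prime_divisors G"
    using iso_same_card[OF assms(3)] by (simp add: prime_divisors_def order_def)
  have "(\<exists>x\<in>carrier H. group.ord H x = n) = (\<exists>x\<in>carrier G. group.ord G x = n)" for n
    unfolding im[symmetric] using iso_ord_eq[OF assms(1,2) f] by auto
  then have "GK_adj H = GK_adj G"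
    by (simp add: GK_adj_def pi fun_eq_iff)
  then have "GK_degree H = GK_degree G"
    by (simp add: GK_degree_def fun_eq_iff)
  then show ?thesis
    by (simp add: degree_pattern_def pi)
qed

lemma nat_copy:
  fixes G :: "('a, 'b) monoid_scheme"
  assumes "group G" "finite (carrier G)"
  obtains H :: "nat monoid" where "group H" "G \<cong> H" "carrier H = {..<order G}"
    "\<And>x y. x \<notin> carrier H \<or> y \<notin> carrier H \<Longrightarrow> x \<otimes>\<^bsub>H\<^esub> y = 0"
proof -
  interpret G: group G by fact
  obtain f where f: "bij_betw f (carrier G) {..<order G}"
    using ex_bij_betw_finite_nat[OF assms(2)] by (auto simp: order_def atLeast0LessThan)
  define g where "g = inv_into (carrier G) f"
  have gf: "g (f x) = x" if "x \<in> carrier G" for x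
    using that f by (simp add: g_def bij_betw_inv_into_left)
  have fc: "f x \<in> {..<order G}" if "x \<in> carrier G" for x
    using that f by (auto simp: bij_betw_def)
  define H :: "nat monoid" where
    "H = \<lparr>carrier = {..<order G},
          monoid.mult = (\<lambda>x y. if x < order G \<and> y < order G then f (g x \<otimes>\<^bsub>G\<^esub> g y) else 0),
          one = f \<one>\<^bsub>G\<^esub>\<rparr>"
  have hom: "f \<in> hom G H"
    using fc by (auto simp: hom_def H_def gf)
  then have iso: "f \<in> iso G H"
    using f by (simp add: iso_def H_def)
  have "group (H\<lparr>one := f \<one>\<^bsub>G\<^esub>\<rparr>)"
    using G.iso_imp_img_group[OF iso] by (simp add: H_def)
  moreover have "H\<lparr>one := f \<one>\<^bsub>G\<^esub>\<rparr> = H"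
    using f by (simp add: H_def bij_betw_def)
  ultimately have "group H" by simp
  moreover have "G \<cong> H" using iso by (rule is_isoI)
  ultimately show ?thesis
    by (rule that) (auto simp: H_def)
qed

lemma OD_groups_complete:
  fixes K :: "('c, 'd) monoid_scheme"
  assumes "group K" "finite (carrier K)" "order K = order G" "degree_pattern K = degree_pattern G"
  shows "\<exists>H\<in>OD_groups G. K \<cong> H"
proof -
  obtain H :: "nat monoid" where H: "group H" "K \<cong> H"
    using nat_copy[OF assms(1,2)] by metis
  then show ?thesis
    using assms iso_same_card[OF H(2)] iso_finite[OF H(2)] iso_degree_pattern[OF assms(1) H]
    by (auto simp: OD_groups_def order_def)
qed

lemma finite_OD_classes: "finite (OD_classes G)"
proof -
  let ?R = "{(H, K). H \<in> OD_groups G \<and> K \<in> OD_groups G \<and> H \<cong> K}"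
  let ?n = "order G"
  define T where "T = (\<lambda>H :: nat monoid. (one H, {(x, y, x \<otimes>\<^bsub>H\<^esub> y) | x y. x < ?n \<and> y < ?n}))"
  define S where "S = {H \<in> OD_groups G. carrier H = {..<?n} \<and>
    (\<forall>x y. x \<notin> carrier H \<or> y \<notin> carrier H \<longrightarrow> x \<otimes>\<^bsub>H\<^esub> y = 0)}"
  have "T ` S \<subseteq> {..<?n} \<times> Pow ({..<?n} \<times> {..<?n} \<times> {..<?n})"
  proof
    fix t assume "t \<in> T ` S"
    then obtain H where H: "H \<in> S" "t = T H" by blast
    then interpret group H by (simp add: S_def OD_groups_def)
    have c: "carrier H = {..<?n}" using H by (simp add: S_def)
    show "t \<in> {..<?n} \<times> Pow ({..<?n} \<times> {..<?n} \<times> {..<?n})"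
      using one_closed m_closed unfolding H(2) T_def c by auto
  qed
  then have "finite (T ` S)"
    by (rule finite_subset) auto
  moreover have "inj_on T S"
  proof (rule inj_onI)
    fix H K assume S: "H \<in> S" "K \<in> S" and eq: "T H = T K"
    have c: "carrier H = {..<?n}" "carrier K = {..<?n}"
      using S by (simp_all add: S_def)
    have "x \<otimes>\<^bsub>H\<^esub> y = x \<otimes>\<^bsub>K\<^esub> y" for x y
    proof (cases "x < ?n \<and> y < ?n")
      case True
      then have "(x, y, x \<otimes>\<^bsub>H\<^esub> y) \<in> snd (T H)" by (auto simp: T_def)
      then show ?thesis unfolding eq by (auto simp: T_def)
    next
      case False
      then show ?thesis using S by (auto simp: S_def)
    qed
    moreover have "one H = one K" using eq by (simp add: T_def)
    ultimately show "H = K"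
      using c by (intro monoid.equality ext) auto
  qed
  ultimately have "finite S" by (rule finite_imageD)
  moreover have "OD_classes G \<subseteq> (\<lambda>H. ?R `` {H}) ` S"
  proof
    fix X assume "X \<in> OD_classes G"
    then obtain K where K: "K \<in> OD_groups G" "X = ?R `` {K}"
      by (auto simp: OD_classes_def quotient_def)
    then have gK: "group K" "finite (carrier K)" "order K = ?n" 
      by (simp_all add: OD_groups_def)
    obtain H :: "nat monoid" where H: "group H" "K \<cong> H" "carrier H = {..<order K}"
      "\<And>x y. x \<notin> carrier H \<or> y \<notin> carrier H \<Longrightarrow> x \<otimes>\<^bsub>H\<^esub> y = 0"
      using nat_copy[OF gK(1,2)] by metis
    have "H \<in> OD_groups G"
      using K(1) gK H iso_degree_pattern[OF gK(1) H(1,2)]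
      by (simp add: OD_groups_def order_def)
    with H gK have "H \<in> S" by (simp add: S_def)
    moreover have "X = ?R `` {H}"
      unfolding K(2) using K(1) \<open>H \<in> OD_groups G\<close> H(2)
      by (intro equiv_class_eq[OF equiv_OD]) auto
    ultimately show "X \<in> (\<lambda>H. ?R `` {H}) ` S" by blast
  qed
  ultimately show ?thesis
    by (meson finite_imageI finite_subset)
qed

end

theory Submission
  imports Defs "HOL-Algebra.Sylow" "HOL-Algebra.Elementary_Groups"
begin

text \<open>Since \<open>625 = 5\<^sup>4\<close>, the groups \<open>A\<^sub>6\<^sub>2\<^sub>4 \<times> L\<close> with \<open>L\<close> one of the five abelian groups of order 625 have
  the order of \<open>A\<^sub>6\<^sub>2\<^sub>5\<close>. They also have the same prime graph. There is no prime between 620 and 625,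
  so 5 is adjacent to every other vertex of both graphs and the factor \<open>L\<close> adds no edge. Any further
  difference would need primes with \<open>r + s = 625\<close>, which is odd, or \<open>s + 4 = 625\<close> (adjacency of \<open>s\<close>
  to 2), and neither occurs. The numbers of solutions of \<open>x ^ 5 = 1\<close> and \<open>x ^ 25 = 1\<close>, which
  are multiplicative over direct products, tell the five products apart, and the simplicity of
  \<open>A\<^sub>6\<^sub>2\<^sub>5\<close> separates it from them.\<close>

subsection \<open>Simplicity of the alternating groups\<close>

lemma three_cycle_mem_alt_group:
  assumes "distinct [a, b, c]" "{a, b, c} \<subseteq> {1..n}"
  shows "cycle_of_list [a, b, c] \<in> carrier (alt_group n)"
proof -
  have "cycle_of_list [a, b, c] \<in> three_cycles n"
    using assms by (intro CollectI exI[of _ "[a, b, c]"]) simp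
  then show ?thesis using three_cycles_incl by blast
qed

lemma ex_fresh:
  fixes A :: "nat set"
  assumes "finite A" "card A < n"
  obtains x where "x \<in> {1..n}" "x \<notin> A"
proof -
  have "\<not> {1..n} \<subseteq> A"
    using assms card_mono[of A "{1..n}"] by auto
  then show ?thesis using that by blast
qed

text \<open>Three transpositions (or identities) bring \<open>a\<close>, \<open>b\<close>,
  \<open>c\<close> to their targets one after the other, each leaving the targets already reached in
  place. If the product is odd, a swap of two points outside \<open>{x, y, z}\<close> repairs the
  parity; \<open>n \<ge> 5\<close> provides them.\<close>

lemma alt_group_three_transitive:
  assumes n: "n \<ge> 5"
    and abc: "distinct [a, b, c]" "{a, b, c} \<subseteq> {1..n}"
    and xyz: "distinct [x, y, z]" "{x, y, z} \<subseteq> {1..n}"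
  obtains q where "q \<in> carrier (alt_group n)" "q a = x" "q b = y" "q c = z"
proof -
  define q1 where "q1 = transpose a x"
  define q2 where "q2 = transpose (q1 b) y \<circ> q1"
  define q3 where "q3 = transpose (q2 c) z \<circ> q2"
  have p1: "q1 permutes {1..n}"
    unfolding q1_def using abc xyz by (intro permutes_swap_id) auto
  have p2: "q2 permutes {1..n}"
    unfolding q2_def using abc xyz p1 permutes_in_image[OF p1]
    by (intro permutes_compose[OF p1] permutes_swap_id) auto
  have p3: "q3 permutes {1..n}"
    unfolding q3_def using abc xyz p2 permutes_in_image[OF p2]
    by (intro permutes_compose[OF p2] permutes_swap_id) auto
  have "q1 a = x" by (simp add: q1_def)
  moreover have "q1 b \<noteq> q1 a"
    using abc permutes_inj[OF p1] by (auto dest: injD)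
  ultimately have q2: "q2 a = x" "q2 b = y"
    using xyz by (auto simp: q2_def)
  moreover have "q2 c \<noteq> q2 a" "q2 c \<noteq> q2 b"
    using abc permutes_inj[OF p2] by (auto dest: injD)
  ultimately have q3: "q3 a = x" "q3 b = y" "q3 c = z"
    using xyz by (auto simp: q3_def)
  show ?thesis
  proof (cases "evenperm q3")
    case True
    then show ?thesis using that q3 p3 by (simp add: alt_group_carrier)
  next
    case False
    have "card {x, y, z} < n" using xyz n by simp
    then obtain u where u: "u \<in> {1..n}" "u \<notin> {x, y, z}"
      using ex_fresh by (metis finite.emptyI finite.insertI)
    have "card {u, x, y, z} < n" using u xyz n by simp
    then obtain v where v: "v \<in> {1..n}" "v \<notin> {u, x, y, z}"
      using ex_fresh by (metis finite.emptyI finite.insertI)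
    have "evenperm (transpose u v \<circ> q3)"
      using False v p3 permutation_permutes[of q3]
      by (subst evenperm_comp) (auto simp: evenperm_swap permutation_swap_id)
    moreover have "transpose u v \<circ> q3 permutes {1..n}"
      using u v by (intro permutes_compose[OF p3] permutes_swap_id) auto
    ultimately show ?thesis
      using that[of "transpose u v \<circ> q3"] q3 u v by (auto simp: alt_group_carrier)
  qed
qed

text \<open>Conjugation by \<open>q\<close> relabels the entries of a 3-cycle, so three-transitivity
  reaches every 3-cycle from the given one, and the 3-cycles generate the alternating group.\<close>

lemma normal_alt_group_three_cycle:
  assumes n: "n \<ge> 5" and N: "N \<lhd> alt_group n"
    and abc: "distinct [a, b, c]" "{a, b, c} \<subseteq> {1..n}" "cycle_of_list [a, b, c] \<in> N"
  shows "N = carrier (alt_group n)"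
proof -
  interpret A: group "alt_group n" by (rule alt_group_is_group)
  interpret N: normal N "alt_group n" by (rule N)
  have "three_cycles n \<subseteq> N"
  proof
    fix p assume "p \<in> three_cycles n"
    then obtain cs where cs: "p = cycle_of_list cs" "cycle cs" "length cs = 3" "set cs \<subseteq> {1..n}"
      by auto
    then obtain x y z where xyz: "cs = [x, y, z]"
      using stupid_lemma by blast
    obtain q where q: "q \<in> carrier (alt_group n)" "q a = x" "q b = y" "q c = z"
      using alt_group_three_transitive[OF n abc(1,2), of x y z] cs xyz by auto
    have "q \<circ> cycle_of_list [a, b, c] \<circ> inv' q \<in> N"
      using N.inv_op_closed2[OF q(1) abc(3)] q(1)
      by (simp add: alt_group_mult alt_group_inv_equality del: cycle_of_list.simps)
    moreover have "q \<circ> cycle_of_list [a, b, c] \<circ> inv' q = cycle_of_list (map q [a, b, c])"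
      using q(1) abc(1) by (intro conjugation_of_cycle) (auto simp: alt_group_carrier permutes_bij)
    ultimately show "p \<in> N"
      using cs(1) xyz q(2-4) by (simp del: cycle_of_list.simps)
  qed
  then have "carrier (alt_group n) \<subseteq> N"
    unfolding alt_group_carrier_as_three_cycles
    by (rule A.generate_subgroup_incl) (rule N.subgroup_axioms)
  then show ?thesis
    using N.subset by blast
qed

text \<open>The product below is the commutator of \<open>s\<close> and the 3-cycle \<open>(a b c)\<close>.\<close>

lemma normal_alt_group_commutator:
  assumes N: "N \<lhd> alt_group n" and s: "s \<in> N"
    and abc: "distinct [a, b, c]" "{a, b, c} \<subseteq> {1..n}"
  shows "cycle_of_list [s a, s b, s c] \<circ> cycle_of_list [c, b, a] \<in> N"
proof -
  interpret A: group "alt_group n" by (rule alt_group_is_group)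
  interpret N: normal N "alt_group n" by (rule N)
  let ?t = "cycle_of_list [a, b, c]"
  have t: "?t \<in> carrier (alt_group n)"
    by (rule three_cycle_mem_alt_group[OF abc])
  have sA: "s \<in> carrier (alt_group n)" using s N.subset by blast
  \<comment> \<open>Read as \<open>s\<close> times a conjugate of its inverse, the commutator lies
    in \<open>N\<close>; read as a conjugate of \<open>?t\<close> times the inverse of
    \<open>?t\<close>, it is a product of two 3-cycles.\<close>
  have "?t \<otimes>\<^bsub>alt_group n\<^esub> inv\<^bsub>alt_group n\<^esub> s \<otimes>\<^bsub>alt_group n\<^esub> inv\<^bsub>alt_group n\<^esub> ?t \<in> N"
    using t s by (intro N.inv_op_closed2 N.m_inv_closed)
  then have "s \<otimes>\<^bsub>alt_group n\<^esub> (?t \<otimes>\<^bsub>alt_group n\<^esub> inv\<^bsub>alt_group n\<^esub> s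
      \<otimes>\<^bsub>alt_group n\<^esub> inv\<^bsub>alt_group n\<^esub> ?t) \<in> N"
    using s by (rule N.m_closed[rotated])
  then have "(s \<circ> ?t \<circ> inv' s) \<circ> inv' ?t \<in> N"
    using sA t
    by (simp add: alt_group_mult alt_group_inv_equality o_assoc del: cycle_of_list.simps)
  moreover have "s \<circ> ?t \<circ> inv' s = cycle_of_list (map s [a, b, c])"
    using sA abc(1) by (intro conjugation_of_cycle) (auto simp: alt_group_carrier permutes_bij)
  moreover have "inv' ?t = cycle_of_list [c, b, a]"
    using abc(1) by (intro inv_unique_comp) (auto simp: fun_eq_iff transpose_def)
  ultimately show ?thesis
    by (simp del: cycle_of_list.simps)
qed

text \<open>The points are consecutive on a cycle of \<open>s\<close> of length at least 4. In that
  case the commutator with \<open>(a b c)\<close> is already a 3-cycle.\<close>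

lemma normal_alt_group_long_cycle:
  assumes n: "n \<ge> 5" and N: "N \<lhd> alt_group n" and s: "s \<in> N"
    and abc: "distinct [a, b, c, d]" "{a, b, c, d} \<subseteq> {1..n}" "s a = b" "s b = c" "s c = d"
  shows "N = carrier (alt_group n)"
proof (rule normal_alt_group_three_cycle[OF n N])
  have "cycle_of_list [b, c, d] \<circ> cycle_of_list [c, b, a] = cycle_of_list [a, d, b]"
    using abc(1) by (auto simp: fun_eq_iff transpose_def)
  then show "cycle_of_list [a, d, b] \<in> N"
    using normal_alt_group_commutator[OF N s, of a b c] abc by (simp del: cycle_of_list.simps)
qed (use abc(1,2) in simp_all)

text \<open>Conjugation by \<open>s\<close> inverts \<open>(a b c)\<close>, so the commutator is the
  square of the inverse, which is \<open>(a b c)\<close> again.\<close>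

lemma normal_alt_group_swap_fixed:
  assumes n: "n \<ge> 5" and N: "N \<lhd> alt_group n" and s: "s \<in> N"
    and abc: "distinct [a, b, c]" "{a, b, c} \<subseteq> {1..n}" "s a = b" "s b = a" "s c = c"
  shows "N = carrier (alt_group n)"
proof (rule normal_alt_group_three_cycle[OF n N])
  have "cycle_of_list [b, a, c] \<circ> cycle_of_list [c, b, a] = cycle_of_list [a, b, c]"
    using abc(1) by (auto simp: fun_eq_iff transpose_def)
  then show "cycle_of_list [a, b, c] \<in> N"
    using normal_alt_group_commutator[OF N s, of a b c] abc by (simp del: cycle_of_list.simps)
qed (use abc(1,2) in simp_all)

lemma normal_alt_group_swap:
  assumes n: "n \<ge> 5" and N: "N \<lhd> alt_group n" and s: "s \<in> N"
    and ab: "a \<noteq> b" "{a, b} \<subseteq> {1..n}" "s a = b" "s b = a"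
  shows "N = carrier (alt_group n)"
proof -
  have sp: "s permutes {1..n}"
    using s N normal_imp_subgroup[OF N] subgroup.subset alt_group_carrier by blast
  have "card {a, b} < n" using n ab by simp
  then obtain c where c: "c \<in> {1..n}" "c \<notin> {a, b}"
    using ex_fresh by (metis finite.emptyI finite.insertI)
  show ?thesis
  proof (cases "s c = c")
    case True
    show ?thesis
      by (rule normal_alt_group_swap_fixed[OF n N s _ _ ab(3,4) True]) (use ab(1,2) c in auto)
  next
    case False
    define d where "d = s c"
    have d: "d \<in> {1..n}" "d \<notin> {a, b, c}"
      using False c ab permutes_in_image[OF sp] permutes_inj[OF sp] 
      by (auto simp: d_def dest: injD)
    have "card {a, b, c, d} < n" using n ab c d by simp
    then obtain e where e: "e \<in> {1..n}" "e \<notin> {a, b, c, d}"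
      using ex_fresh by (metis finite.emptyI finite.insertI)
    \<comment> \<open>This commutator is \<open>(a c)(b d)\<close>. It swaps two points and fixes
      \<open>e\<close>, even if \<open>s\<close> itself fixes no point, so
      \<open>normal_alt_group_swap_fixed\<close> applies to it in place of \<open>s\<close>.\<close>
    let ?r = "cycle_of_list [s a, s b, s c] \<circ> cycle_of_list [c, b, a]"
    have r: "?r \<in> N"
      using ab c by (intro normal_alt_group_commutator[OF N s]) auto
    have r_eq: "?r a = c" "?r c = a" "?r e = e"
      using ab c d e by (auto simp: transpose_def simp flip: d_def)
    have "distinct [a, c, e]" "{a, c, e} \<subseteq> {1..n}"
      using ab(2) c e by simp_all
    then show ?thesis
      using r_eq by (rule normal_alt_group_swap_fixed[OF n N r])
  qed
qed

lemma normal_alt_group_nontrivial: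
  assumes n: "n \<ge> 5" and N: "N \<lhd> alt_group n" and s: "s \<in> N" "s \<noteq> id"
  shows "N = carrier (alt_group n)"
proof -
  have sp: "s permutes {1..n}"
    using s N normal_imp_subgroup[OF N] subgroup.subset alt_group_carrier by blast
  note inj = inj_eq[OF permutes_inj[OF sp]] and im = permutes_in_image[OF sp]
  obtain a where a: "s a \<noteq> a" using s(2) by (auto simp: fun_eq_iff)
  define b c d where "b = s a" and "c = s b" and "d = s c"
  have ab: "a \<noteq> b" "c \<noteq> b" "d \<noteq> c" using a by (auto simp: b_def c_def d_def inj)
  have "a \<in> {1..n}" using a sp by (metis permutes_not_in)
  then have in_n: "{a, b, c, d} \<subseteq> {1..n}" using im by (simp add: b_def c_def d_def)
  \<comment> \<open>The cycle of \<open>s\<close> through \<open>a\<close> has length 2, at least 4,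
    or 3, in this order.\<close>
  consider "c = a" | "c \<noteq> a" "d \<noteq> a" | "c \<noteq> a" "d = a" by blast
  then show ?thesis
  proof cases
    case 1
    then show ?thesis
      using normal_alt_group_swap[OF n N s(1) ab(1) _ b_def[symmetric]] in_n c_def by simp
  next
    case 2
    moreover have "d \<noteq> b" using 2 by (auto simp: b_def c_def d_def inj)
    ultimately show ?thesis
      using ab in_n
      by (intro normal_alt_group_long_cycle[OF n N s(1), of a b c d]) (auto simp flip: b_def c_def d_def)
  next
    case 3
    have abc: "s a = b" "s b = c" "s c = a" using 3 by (simp_all add: b_def c_def d_def)
    show ?thesis
    proof (cases "\<forall>x. x \<notin> {a, b, c} \<longrightarrow> s x = x")
      case True
      have "s x = cycle_of_list [a, b, c] x" for x
        using ab 3 abc True by (cases "x \<in> {a, b, c}") (auto simp: transpose_def)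
      then have "s = cycle_of_list [a, b, c]" by blast
      then show ?thesis
        using normal_alt_group_three_cycle[OF n N, of a b c] ab 3 in_n s(1)
        by (auto simp del: cycle_of_list.simps)
    next
      case False
      then obtain x where x: "x \<notin> {a, b, c}" "s x \<noteq> x" by blast
      then have sx: "s x \<notin> {a, b, c, x}" using abc inj by (metis insert_iff singletonD)
      have "x \<in> {1..n}" using x sp by (metis permutes_not_in)
      \<comment> \<open>Besides the cycle \<open>(a b c)\<close>, \<open>s\<close> moves
        \<open>x\<close>. The commutator with \<open>(a b x)\<close> sends \<open>a\<close> to
        \<open>x\<close>, \<open>x\<close> to \<open>c\<close> and \<open>c\<close> to
        \<open>s x\<close>, so it has a cycle of length at least 4.\<close>
      let ?r = "cycle_of_list [s a, s b, s x] \<circ> cycle_of_list [x, b, a]"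
      have r: "?r \<in> N"
        using ab in_n x \<open>x \<in> {1..n}\<close> by (intro normal_alt_group_commutator[OF N s(1)]) auto
      have r_eq: "?r a = x" "?r x = c" "?r c = s x"
        using ab 3 x sx abc by (auto simp: transpose_def)
      have "s x \<in> {1..n}" using \<open>x \<in> {1..n}\<close> im by blast
      then have "distinct [a, x, c, s x]" "{a, x, c, s x} \<subseteq> {1..n}"
        using 3(1) x sx in_n \<open>x \<in> {1..n}\<close> by simp_all
      then show ?thesis
        using r_eq by (rule normal_alt_group_long_cycle[OF n N r])
    qed
  qed
qed

lemma simple_alt_group:
  assumes n: "n \<ge> 5"
  shows "simple_group (alt_group n)"
proof -
  interpret A: group "alt_group n" by (rule alt_group_is_group)
  show ?thesis
  proof
    have "(5::nat) \<le> fact 5" by (rule fact_ge_self)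
    also have "fact 5 \<le> (fact n :: nat)" using n by (rule fact_mono_nat)
    finally show "order (alt_group n) > 1"
      using alt_group_card_carrier[of n] n by (simp add: order_def)
  next
    fix N assume N: "N \<lhd> alt_group n"
    then have "id \<in> N"
      using subgroup.one_closed[OF normal_imp_subgroup] by (metis alt_group_one)
    then show "N = carrier (alt_group n) \<or> N = {\<one>\<^bsub>alt_group n\<^esub>}"
      using normal_alt_group_nontrivial[OF n N] by (auto simp: alt_group_one)
  qed
qed

subsection \<open>Element orders in alternating groups\<close>

lemma (in group) cauchy_prime_order:
  assumes fin: "finite (carrier G)" and p: "Factorial_Ring.prime p" "p dvd order G"
  obtains x where "x \<in> carrier G" "ord x = p"
proof -
  \<comment> \<open>\<open>sylow_thm\<close> covers every power of \<open>p\<close> dividing the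
    order, so exponent 1 yields a subgroup of order \<open>p\<close> itself.\<close>
  obtain m where "order G = p ^ 1 * m" using p(2) by auto
  then obtain H where H: "subgroup H G" "card H = p"
    using sylow_thm[of p G 1 m] p(1) fin is_group by auto
  interpret H: subgroup H G by fact
  interpret HG: group "G\<lparr>carrier := H\<rparr>" by (rule H.subgroup_is_group) (rule is_group)
  have "H \<noteq> {\<one>}"
    using H(2) p(1) by auto
  then obtain x where x: "x \<in> H" "x \<noteq> \<one>"
    using H.one_closed by blast
  have "x [^] p = \<one>"
    using HG.pow_order_eq_1[of x] x(1) H(2) by (simp add: order_def nat_pow_def)
  then have "ord x dvd p" using x by (simp add: pow_eq_id)
  moreover have "ord x \<noteq> 1" using x ord_eq_1 by auto
  ultimately show ?thesis
    using that[of x] x(1) p(1) by (metis H.mem_carrier prime_nat_iff)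
qed

lemma dvd_mult_primes_eq:
  fixes r s d :: nat
  assumes "Factorial_Ring.prime r" "Factorial_Ring.prime s" "d dvd r * s" "\<not> d dvd r" "\<not> d dvd s"
  shows "d = r * s"
proof -
  obtain a b where ab: "d = a * b" "a dvd r" "b dvd s"
    using division_decomp[OF assms(3)] by blast
  then have "a = 1 \<or> a = r" "b = 1 \<or> b = s"
    using assms(1,2) by (simp_all add: prime_nat_iff)
  then show ?thesis using ab assms(4,5) by auto
qed

text \<open>Were the order of the product to divide \<open>r\<close>, then
  \<open>x [^] r = \<one>\<close> would force \<open>y [^] r = \<one>\<close> and hence
  \<open>s dvd r\<close>; likewise for \<open>s\<close>.\<close>

lemma (in group) ord_mult_distinct_primes:
  assumes rs: "Factorial_Ring.prime r" "Factorial_Ring.prime s" "r \<noteq> s"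
    and xy: "x \<in> carrier G" "y \<in> carrier G" "x \<otimes> y = y \<otimes> x" "ord x = r" "ord y = s"
  shows "ord (x \<otimes> y) = r * s"
proof (rule dvd_mult_primes_eq[OF rs(1,2)])
  show "ord (x \<otimes> y) dvd r * s"
    using ord_mul_divides[OF xy(3,1,2)] xy by simp
  have pow: "ord (x \<otimes> y) dvd k \<longleftrightarrow> x [^] k \<otimes> y [^] k = \<one>" for k :: nat
    using xy pow_mult_distrib[OF xy(3,1,2)] by (simp flip: pow_eq_id)
  have "\<not> s dvd r" "\<not> r dvd s"
    using rs primes_dvd_imp_eq by blast+
  moreover have "x [^] r = \<one>" "y [^] s = \<one>"
    using xy pow_ord_eq_1 by auto
  ultimately show "\<not> ord (x \<otimes> y) dvd r" "\<not> ord (x \<otimes> y) dvd s"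
    unfolding pow using xy pow_eq_id nat_pow_closed l_one r_one by metis+
qed

lemma alt_group_pow: "x [^]\<^bsub>alt_group n\<^esub> (k::nat) = x ^^ k"
proof -
  interpret group "alt_group n" by (rule alt_group_is_group)
  show ?thesis
    by (induction k) (simp_all add: alt_group_one alt_group_mult funpow_Suc_right del: funpow.simps(2))
qed

lemma alt_group_ord_dvd:
  assumes "x \<in> carrier (alt_group n)"
  shows "group.ord (alt_group n) x dvd k \<longleftrightarrow> x ^^ k = id"
  using group.pow_eq_id[OF alt_group_is_group assms] by (simp add: alt_group_pow alt_group_one)

text \<open>The permutations are functions on all natural numbers that fix everything outside
  \<open>{1..m}\<close>, so the smaller group is literally contained in the larger one.\<close>

lemma alt_group_mono:
  assumes "x \<in> carrier (alt_group m)" "m \<le> n"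
  shows "x \<in> carrier (alt_group n)" "group.ord (alt_group n) x = group.ord (alt_group m) x"
proof -
  show x: "x \<in> carrier (alt_group n)"
    using assms permutes_subset[of x "{1..m}" "{1..n}"] by (auto simp: alt_group_carrier)
  show "group.ord (alt_group n) x = group.ord (alt_group m) x"
    using alt_group_ord_dvd[OF x] alt_group_ord_dvd[OF assms(1)] by (metis dvd_antisym dvd_refl)
qed

lemma finite_alt_group: "finite (carrier (alt_group n))"
  by (rule finite_subset[OF _ finite_permutations[of "{1..n}"]]) (auto simp: alt_group_carrier)

lemma prime_dvd_order_alt_group:
  assumes "Factorial_Ring.prime p" "p dvd order (alt_group n)" "n \<ge> 2"
  shows "p \<le> n"
proof -
  have "p dvd fact n"
    using assms alt_group_card_carrier[of n] by (metis dvd_mult order_def)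
  then show ?thesis
    using assms(1) by (simp add: prime_dvd_fact_iff)
qed

text \<open>All cycle lengths of \<open>x\<close> divide \<open>r * s\<close>, but not all divide
  \<open>r\<close> and not all divide \<open>s\<close>. Hence there is a cycle of length
  \<open>r * s\<close>, which is at least \<open>r + s\<close>, or there are cycles of lengths
  \<open>r\<close> and \<open>s\<close>; the latter are disjoint because their lengths
  differ.\<close>

lemma order_mult_primes_le:
  assumes rs: "Factorial_Ring.prime r" "Factorial_Ring.prime s" "r \<noteq> s"
    and x: "x \<in> carrier (alt_group n)" "group.ord (alt_group n) x = r * s"
  shows "r + s \<le> n"
proof -
  have p: "x permutes {1..n}" using x by (simp add: alt_group_carrier)
  have perm: "permutation x" using x(1) by (rule alt_group_carrier')
  \<comment> \<open>The length of the cycle through a point, and the set of points on that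
    cycle.\<close>
  let ?d = "least_power x" and ?O = "\<lambda>a. set (support x a)"
  have dvd: "?d a dvd r * s" for a
    using alt_group_ord_dvd[OF x(1), of "r * s"] x(2) by (simp add: least_power_dvd[OF perm])
  \<comment> \<open>Phrased with \<open>{t, q} = {r, s}\<close> so that it can be applied with the
    two primes in either role.\<close>
  have prime_period: "?d a = q"
    if "Factorial_Ring.prime t" "Factorial_Ring.prime q" "{t, q} = {r, s}" "\<not> ?d a dvd t" "?d a \<noteq> r * s" for a t q
  proof -
    have rs_eq: "t * q = r * s" using that(3) by (auto simp: doubleton_eq_iff)
    then have "?d a dvd q"
      using that dvd_mult_primes_eq[of t q "?d a"] dvd[of a] by auto
    moreover have "?d a \<noteq> 1" using that(4) by auto
    ultimately show ?thesis using that(2) by (auto simp: prime_nat_iff)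
  qed
  have O_card: "card (?O a) = ?d a" for a
    using distinct_card[OF cycle_of_permutation[OF perm, of a]] by simp
  \<comment> \<open>A fixed point may lie outside \<open>{1..n}\<close>; only the cycles of moved
    points are confined to it.\<close>
  have O_sub: "?O a \<subseteq> {1..n}" if "x a \<noteq> a" for a
  proof -
    have "a \<in> {1..n}" using that p by (metis permutes_not_in)
    then show ?thesis
      using permutes_in_image[OF permutes_funpow[OF p]] by (auto simp del: atLeastAtMost_iff)
  qed
  have "(x ^^ k) a = a" if "x a = a" for k a
    using that by (induction k) auto
  then have moved: "x a \<noteq> a" if "(x ^^ k) a \<noteq> a" for k a
    using that by blast
  \<comment> \<open>If every cycle length divided \<open>t\<close>, then \<open>x ^^ t\<close> would
    be the identity and \<open>r * s\<close> would divide \<open>t\<close>.\<close>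
  have ex: "\<exists>a. \<not> ?d a dvd t" if "t \<in> {r, s}" for t
  proof (rule ccontr)
    assume "\<not> ?thesis"
    then have "x ^^ t = id" by (auto simp: least_power_dvd[OF perm])
    then have "r * s dvd t" using alt_group_ord_dvd[OF x(1)] x(2) by simp
    moreover have "t < r * s" "t > 0"
      using that prime_gt_1_nat[OF rs(1)] prime_gt_1_nat[OF rs(2)] by auto
    ultimately show False using dvd_imp_le by fastforce
  qed
  then obtain a b where ab: "\<not> ?d a dvd r" "\<not> ?d b dvd s" by blast
  then have mv: "x a \<noteq> a" "x b \<noteq> b"
    using moved by (auto simp: least_power_dvd[OF perm])
  have big: "r + s \<le> n" if "?d c = r * s" "x c \<noteq> c" for c
  proof -
    have "r + s \<le> r * s"
      using prime_ge_2_nat[OF rs(1)] prime_ge_2_nat[OF rs(2)]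
      by (metis add_le_mono le_refl mult_le_mono1 mult_le_mono2 mult_2 mult_2_right nat_le_linear order_trans)
    also have "\<dots> = card (?O c)"
      using O_card[of c] that(1) by (simp only:)
    also have "\<dots> \<le> card {1..n}"
      using O_sub[OF that(2)] by (intro card_mono) blast+
    finally show ?thesis by simp
  qed
  show ?thesis
  proof (cases "?d a = r * s \<or> ?d b = r * s")
    case True
    then show ?thesis using big mv by blast
  next
    case False
    then have d: "?d a = s" "?d b = r"
      using ab rs prime_period[of r s a] prime_period[of s r b] by auto
    then have O: "card (?O a) = s" "card (?O b) = r"
      using O_card[of a] O_card[of b] by metis+
    then have "?O a \<noteq> ?O b" using rs(3) by metis
    then have "?O a \<inter> ?O b = {}"
      using disjoint_support[OF perm] by (auto simp only: disjoint_def)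
    then have "s + r = card (?O a \<union> ?O b)"
      by (subst card_Un_disjoint) (simp_all only: O finite_set)
    also have "\<dots> \<le> card {1..n}"
      using O_sub mv by (intro card_mono) blast+
    finally show ?thesis by simp
  qed
qed

text \<open>The least degree of an alternating group containing an element of prime order \<open>p\<close>.\<close>

definition alt_prime_degree :: "nat \<Rightarrow> nat" where
  "alt_prime_degree p = (if p = 2 then 4 else p)"

text \<open>By Cauchy's theorem only divisibility of the order is at stake. An odd \<open>p\<close>
  divides \<open>fact p\<close> and hence its half; for \<open>p = 2\<close> the first alternating
  group of even order is that of degree 4.\<close>

lemma ex_alt_group_prime_order:
  assumes p: "Factorial_Ring.prime p"
  obtains x where "x \<in> carrier (alt_group (alt_prime_degree p))"
    "group.ord (alt_group (alt_prime_degree p)) x = p"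
proof -
  have "p dvd order (alt_group (alt_prime_degree p))"
  proof (cases "p = 2")
    case True
    then show ?thesis
      using alt_group_card_carrier[of 4] by (simp add: alt_prime_degree_def order_def fact_numeral)
  next
    case False
    have "2 * order (alt_group p) = fact p"
      using alt_group_card_carrier[of p] prime_ge_2_nat[OF p] by (simp add: order_def)
    then have "p dvd 2 * order (alt_group p)"
      using p by (simp add: prime_dvd_fact_iff)
    moreover have "\<not> p dvd 2"
      using False p primes_dvd_imp_eq two_is_prime_nat by blast
    ultimately show ?thesis
      using False p prime_dvd_mult_iff by (auto simp: alt_prime_degree_def)
  qed
  then show ?thesis
    using group.cauchy_prime_order[OF alt_group_is_group finite_alt_group p] that by blast
qed

text \<open>An element of order \<open>r\<close> on the first points and one of order
  \<open>s\<close> on the last points have disjoint supports, so they commute and their orders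
  multiply.\<close>

lemma ex_alt_group_order_mult_primes:
  assumes rs: "Factorial_Ring.prime r" "Factorial_Ring.prime s" "r \<noteq> s"
    and n: "alt_prime_degree r + alt_prime_degree s \<le> n"
  shows "\<exists>x\<in>carrier (alt_group n). group.ord (alt_group n) x = r * s"
proof -
  interpret group "alt_group n" by (rule alt_group_is_group)
  let ?k = "alt_prime_degree r" and ?l = "alt_prime_degree s"
  obtain x where x: "x \<in> carrier (alt_group ?k)" "group.ord (alt_group ?k) x = r"
    using ex_alt_group_prime_order[OF rs(1)] by blast
  obtain z where z: "z \<in> carrier (alt_group ?l)" "group.ord (alt_group ?l) z = s"
    using ex_alt_group_prime_order[OF rs(2)] by blast
  have xn: "x \<in> carrier (alt_group n)" "ord x = r"
    using alt_group_mono[OF x(1), of n] x(2) n by auto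
  have zn: "z \<in> carrier (alt_group n)" "ord z = s"
    using alt_group_mono[OF z(1), of n] z(2) n by auto
  \<comment> \<open>The reversal of \<open>{1..n}\<close>, an involution. Conjugating by it moves
    \<open>z\<close> from the first \<open>?l\<close> points to the last \<open>?l\<close>. Since
    \<open>f\<close> may be odd, evenness and order of the conjugate are established directly and
    not by conjugation inside the group.\<close>
  define f where "f = (\<lambda>i. if i \<in> {1..n} then n + 1 - i else i)"
  have ff: "f \<circ> f = id" by (auto simp: f_def fun_eq_iff)
  then have inv_f: "inv' f = f" by (intro inv_unique_comp)
  have fp: "f permutes {1..n}"
    using o_bij[OF ff ff] by (auto simp: permutes_def bij_iff f_def)
  define y where "y = f \<circ> z \<circ> f"
  have y_pow: "y ^^ k = f \<circ> z ^^ k \<circ> f" for k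
  proof (induction k)
    case (Suc k)
    have "y ^^ Suc k = y \<circ> (f \<circ> z ^^ k \<circ> f)"
      by (subst Suc[symmetric]) simp
    also have "\<dots> = f \<circ> z \<circ> (f \<circ> f) \<circ> z ^^ k \<circ> f"
      by (simp add: y_def o_assoc)
    finally show ?case by (simp add: ff o_assoc)
  qed (simp add: ff)
  have zp: "z permutes {1..n}" and ze: "evenperm z"
    using zn by (simp_all add: alt_group_carrier)
  have "permutation f" "permutation z"
    using fp zp by (auto simp: permutation_permutes)
  then have "evenperm y"
    using ze by (simp add: y_def evenperm_comp permutation_compose)
  then have yn: "y \<in> carrier (alt_group n)"
    using fp zp by (simp add: alt_group_carrier y_def permutes_compose)
  have "f \<circ> g \<circ> f = id \<longleftrightarrow> g = id" for g
    using ff by (metis comp_id fun.map_comp id_comp)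
  then have "ord y dvd k \<longleftrightarrow> ord z dvd k" for k
    by (simp add: alt_group_ord_dvd[OF yn] alt_group_ord_dvd[OF zn(1)] y_pow)
  then have "ord y = s" using zn(2) by (metis dvd_antisym dvd_refl)
  have xp: "x permutes {1..?k}" using x by (simp add: alt_group_carrier)
  have yp: "y permutes {n+1-?l..n}"
  proof -
    have zl: "z permutes {1..?l}" using z by (simp add: alt_group_carrier)
    have "y i = i" if "i \<notin> {n+1-?l..n}" for i
    proof -
      have "f i \<notin> {1..?l}" using that n by (auto simp: f_def)
      then show ?thesis using ff permutes_not_in[OF zl] by (simp add: y_def fun_eq_iff)
    qed
    then show ?thesis
      using yn by (auto simp: alt_group_carrier permutes_def)
  qed
  have "x \<circ> y = y \<circ> x"
  proof
    fix i
    consider "i \<in> {1..?k}" | "i \<in> {n+1-?l..n}" | "i \<notin> {1..?k}" "i \<notin> {n+1-?l..n}" by blast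
    then show "(x \<circ> y) i = (y \<circ> x) i"
    proof cases
      case 1
      then have "x i \<in> {1..?k}" using permutes_in_image[OF xp] by blast
      then have "i \<notin> {n+1-?l..n}" "x i \<notin> {n+1-?l..n}" using 1 n by auto
      then show ?thesis using permutes_not_in[OF yp] by simp
    next
      case 2
      then have "y i \<in> {n+1-?l..n}" using permutes_in_image[OF yp] by blast
      then have "i \<notin> {1..?k}" "y i \<notin> {1..?k}" using 2 n by auto
      then show ?thesis using permutes_not_in[OF xp] by simp
    qed (use permutes_not_in[OF xp] permutes_not_in[OF yp] in auto)
  qed
  then have "ord (x \<otimes>\<^bsub>alt_group n\<^esub> y) = r * s"
    using ord_mult_distinct_primes[OF rs xn(1) yn _ xn(2) \<open>ord y = s\<close>] by (simp add: alt_group_mult)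
  then show ?thesis
    using xn(1) yn by blast
qed

subsection \<open>Direct products\<close>

lemma DirProd_pow:
  "(x, y) [^]\<^bsub>G \<times>\<times> H\<^esub> (k::nat) = (x [^]\<^bsub>G\<^esub> k, y [^]\<^bsub>H\<^esub> k)"
  by (induction k) simp_all

lemma order_DirProd: "order (G \<times>\<times> H) = order G * order H"
  by (simp add: order_def card_cartesian_product)

lemma DirProd_ord_dvd:
  assumes "group G" "group H" "x \<in> carrier G" "y \<in> carrier H"
  shows "group.ord (G \<times>\<times> H) (x, y) dvd k \<longleftrightarrow> group.ord G x dvd k \<and> group.ord H y dvd k"
  using group.pow_eq_id[OF DirProd_group[OF assms(1,2)], of "(x, y)" k]
    group.pow_eq_id[OF assms(1,3), of k] group.pow_eq_id[OF assms(2,4), of k] assms(3,4)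
  by (simp add: DirProd_pow)

text \<open>The first factor is a normal subgroup, and its order lies strictly between 1 and that of
  the product.\<close>

lemma not_simple_DirProd:
  assumes G: "group G" "order G > 1" and H: "group H" "order H > 1"
  shows "\<not> simple_group (G \<times>\<times> H)"
proof
  assume "simple_group (G \<times>\<times> H)"
  interpret G: group G by fact
  interpret H: group H by fact
  have fin: "finite (carrier G)" "finite (carrier H)"
    using assms by (simp_all add: order_def card_ge_0_finite)
  have "carrier G \<lhd> G" "{\<one>\<^bsub>H\<^esub>} \<lhd> H"
    by (simp_all add: G.normal_inv_iff G.subgroup_self H.one_is_normal)
  then have "carrier G \<times> {\<one>\<^bsub>H\<^esub>} \<lhd> G \<times>\<times> H"
    by (rule G.DirProd_normal[OF H(1)])
  then have "carrier G \<times> {\<one>\<^bsub>H\<^esub>} = carrier (G \<times>\<times> H) \<or> carrier G \<times> {\<one>\<^bsub>H\<^esub>} = {\<one>\<^bsub>G \<times>\<times> H\<^esub>}"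
    by (rule simple_group.no_real_normal_subgroup[OF \<open>simple_group (G \<times>\<times> H)\<close>])
  then have "card (carrier G \<times> {\<one>\<^bsub>H\<^esub>}) = card (carrier G \<times> carrier H)
      \<or> card (carrier G \<times> {\<one>\<^bsub>H\<^esub>}) = 1"
    by auto
  then show False
    using assms by (auto simp: card_cartesian_product order_def)
qed

section \<open>Counting the solutions of \<open>x ^ k = 1\<close>\<close>

definition card_pow_eq_one :: "nat \<Rightarrow> ('a, 'b) monoid_scheme \<Rightarrow> nat" where
  "card_pow_eq_one k G = card {x \<in> carrier G. x [^]\<^bsub>G\<^esub> k = \<one>\<^bsub>G\<^esub>}"

lemma card_pow_eq_one_DirProd:
  "card_pow_eq_one k (G \<times>\<times> H) = card_pow_eq_one k G * card_pow_eq_one k H"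
proof -
  have "{z \<in> carrier (G \<times>\<times> H). z [^]\<^bsub>G \<times>\<times> H\<^esub> k = \<one>\<^bsub>G \<times>\<times> H\<^esub>} =
      {x \<in> carrier G. x [^]\<^bsub>G\<^esub> k = \<one>\<^bsub>G\<^esub>} \<times> {y \<in> carrier H. y [^]\<^bsub>H\<^esub> k = \<one>\<^bsub>H\<^esub>}"
    by (auto simp: DirProd_pow)
  then show ?thesis
    by (simp add: card_pow_eq_one_def card_cartesian_product)
qed

lemma card_pow_eq_one_iso:
  assumes "group G" "group H" "G \<cong> H"
  shows "card_pow_eq_one k G = card_pow_eq_one k H"
proof -
  obtain f where f: "f \<in> iso G H" using assms(3) by (auto simp: is_iso_def)
  then have bij: "bij_betw f (carrier G) (carrier H)" by (simp add: iso_def)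
  then have im: "f ` carrier G = carrier H" by (simp add: bij_betw_def)
  have "f x [^]\<^bsub>H\<^esub> k = \<one>\<^bsub>H\<^esub> \<longleftrightarrow> x [^]\<^bsub>G\<^esub> k = \<one>\<^bsub>G\<^esub>" if "x \<in> carrier G" for x
    using that iso_ord_eq[OF assms(1,2) f that] bij_betwE[OF bij]
    by (simp add: group.pow_eq_id[OF assms(1)] group.pow_eq_id[OF assms(2)])
  then have "f ` {x \<in> carrier G. x [^]\<^bsub>G\<^esub> k = \<one>\<^bsub>G\<^esub>} = {y \<in> carrier H. y [^]\<^bsub>H\<^esub> k = \<one>\<^bsub>H\<^esub>}"
    using bij by (auto simp: bij_betw_def simp flip: im)
  then have "bij_betw f {x \<in> carrier G. x [^]\<^bsub>G\<^esub> k = \<one>\<^bsub>G\<^esub>} {y \<in> carrier H. y [^]\<^bsub>H\<^esub> k = \<one>\<^bsub>H\<^esub>}"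
    using bij by (auto simp: bij_betw_def inj_on_def)
  then show ?thesis
    unfolding card_pow_eq_one_def by (rule bij_betw_same_card)
qed

lemma card_pow_eq_one_pos:
  assumes "group G" "finite (carrier G)"
  shows "card_pow_eq_one k G > 0"
proof -
  interpret group G by fact
  have "\<one>\<^bsub>G\<^esub> \<in> {x \<in> carrier G. x [^]\<^bsub>G\<^esub> k = \<one>\<^bsub>G\<^esub>}" by simp
  then show ?thesis
    unfolding card_pow_eq_one_def using assms(2) by (subst card_gt_0_iff) auto
qed

text \<open>Written additively, the solutions are the multiples of \<open>n div gcd k n\<close>
  among \<open>0, ..., n - 1\<close>.\<close>

lemma card_pow_eq_one_integer_mod_group:
  assumes n: "n > 0"
  shows "card_pow_eq_one k (integer_mod_group n) = gcd k n"
proof -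
  define g m where "g = gcd k n" and "m = n div g"
  have g: "g > 0" "n = g * m" "m > 0" 
    using n by (auto simp: g_def m_def div_greater_zero_iff gcd_le2_nat)
  have "coprime (k div g) m"
    using n unfolding g_def m_def by (intro div_gcd_coprime) auto
  then have cop: "coprime (int m) (int (k div g))"
    by (simp add: coprime_commute)
  have k: "k = g * (k div g)" by (simp add: g_def)
  have "int n dvd int k * x \<longleftrightarrow> int m dvd x" for x
  proof -
    have "int n dvd int k * x \<longleftrightarrow> int g * int m dvd int g * (int (k div g) * x)"
      using g(2) k by (metis mult.assoc of_nat_mult)
    also have "\<dots> \<longleftrightarrow> int m dvd int (k div g) * x"
      using g(1) by simp
    also have "\<dots> \<longleftrightarrow> int m dvd x"
      using cop by (simp add: coprime_dvd_mult_right_iff)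
    finally show ?thesis .
  qed
  then have "{x \<in> carrier (integer_mod_group n). x [^]\<^bsub>integer_mod_group n\<^esub> k = \<one>\<^bsub>integer_mod_group n\<^esub>}
      = {x \<in> {0..<int n}. int m dvd x}"
    using n by (auto simp: carrier_integer_mod_group mod_eq_0_iff_dvd)
  also have "\<dots> = (\<lambda>i. int m * int i) ` {..<g}"
  proof (intro equalityI subsetI)
    fix x assume "x \<in> {x \<in> {0..<int n}. int m dvd x}"
    then obtain j where j: "x = int m * j" "0 \<le> x" "x < int g * int m"
      using g(2) by auto
    then have "0 \<le> j" using g(3) by (simp add: zero_le_mult_iff)
    moreover have "j < int g" using j(1,3) g(3) by (simp add: mult.commute)
    ultimately show "x \<in> (\<lambda>i. int m * int i) ` {..<g}"
      using j(1) by (intro image_eqI[of _ _ "nat j"]) auto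
  next
    fix x assume "x \<in> (\<lambda>i. int m * int i) ` {..<g}"
    then obtain i where "x = int m * int i" "i < g" by auto
    then show "x \<in> {x \<in> {0..<int n}. int m dvd x}"
      using g by (simp add: mult.commute)
  qed
  finally show ?thesis
    using g(3) unfolding card_pow_eq_one_def
    by (simp add: card_image inj_on_def g_def)
qed

subsection \<open>Degree patterns\<close>

text \<open>Both sides reduce to the same numerical condition. In the gap hypothesis, the 4 serves
  adjacency to 2, which costs four points, and \<open>q\<close> serves adjacency to the prime
  dividing the order of \<open>L\<close>.\<close>

lemma GK_adj_alt_group_DirProd_iff:
  fixes L :: "('a, 'b) monoid_scheme"
  assumes q: "Factorial_Ring.prime q" "odd q" and n: "n = q ^ k" "n > 1"
    and gap: "\<And>p. Factorial_Ring.prime p \<Longrightarrow> p \<le> n \<Longrightarrow> p + max 4 q < n"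
    and L: "group L" "order L = n"
    and rs: "Factorial_Ring.prime r" "Factorial_Ring.prime s" "r \<noteq> s" "r \<le> n" "s \<le> n"
  shows "(\<exists>x\<in>carrier (alt_group n). group.ord (alt_group n) x = r * s) \<longleftrightarrow> r + s \<le> n" (is "?A \<longleftrightarrow> _")
    and "(\<exists>z\<in>carrier (alt_group (n - 1) \<times>\<times> L). group.ord (alt_group (n - 1) \<times>\<times> L) z = r * s)
      \<longleftrightarrow> r + s \<le> n" (is "?B \<longleftrightarrow> _")
proof -
  interpret L: group L by fact
  interpret B: group "alt_group (n - 1)" by (rule alt_group_is_group)
  interpret BL: group "alt_group (n - 1) \<times>\<times> L" by (rule DirProd_group[OF B.is_group L.is_group])
  \<comment> \<open>The bound improves from \<open>n\<close> to \<open>n - 1\<close>: by the gap if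
    one prime is 2, and otherwise because \<open>r + s\<close> is even while \<open>n\<close> is
    odd.\<close>
  have sum_le: "alt_prime_degree r + alt_prime_degree s \<le> n - 1" if "r + s \<le> n"
  proof (cases "r = 2 \<or> s = 2")
    case True
    then show ?thesis
      using rs(3) gap[OF rs(1,4)] gap[OF rs(2,5)] by (auto simp: alt_prime_degree_def)
  next
    case False
    then have "odd r" "odd s" using rs(1,2) by (simp_all add: prime_odd_nat prime_gt_1_nat nat_less_le prime_ge_2_nat)
    moreover have "odd n" using q(2) n by simp
    ultimately have "r + s \<noteq> n" by (metis odd_even_add)
    then show ?thesis using that False by (simp add: alt_prime_degree_def)
  qed
  have B_ex: "\<exists>x\<in>carrier (alt_group (n - 1)). B.ord x = r * s" if "r + s \<le> n"
    using ex_alt_group_order_mult_primes[OF rs(1-3) sum_le[OF that]] .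
  show "?A \<longleftrightarrow> r + s \<le> n"
  proof
    assume "r + s \<le> n"
    then obtain x where x: "x \<in> carrier (alt_group (n - 1))" "B.ord x = r * s"
      using B_ex by blast
    then show ?A
      using alt_group_mono[OF x(1), of n] by auto
  qed (use order_mult_primes_le[OF rs(1-3)] in blast)
  show "?B \<longleftrightarrow> r + s \<le> n"
  proof
    assume "r + s \<le> n"
    then obtain x where x: "x \<in> carrier (alt_group (n - 1))" "B.ord x = r * s"
      using B_ex by blast
    then have "BL.ord (x, \<one>\<^bsub>L\<^esub>) dvd j \<longleftrightarrow> r * s dvd j" for j
      using DirProd_ord_dvd[OF B.is_group L.is_group x(1) L.one_closed] by simp
    then have "BL.ord (x, \<one>\<^bsub>L\<^esub>) = r * s" by (metis dvd_antisym dvd_refl)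
    then show ?B using x(1) by (intro bexI[of _ "(x, \<one>\<^bsub>L\<^esub>)"]) auto
  next
    assume ?B
    then obtain x l where xl: "x \<in> carrier (alt_group (n - 1))" "l \<in> carrier L" "BL.ord (x, l) = r * s"
      by auto
    have dvd: "r * s dvd j \<longleftrightarrow> B.ord x dvd j \<and> L.ord l dvd j" for j
      using DirProd_ord_dvd[OF B.is_group L.is_group xl(1,2)] xl(3) by simp
    show "r + s \<le> n"
    proof (cases "q = r \<or> q = s")
      case True
      \<comment> \<open>If \<open>q\<close> is one of the two primes, the gap applied to the other
        one gives the bound whatever the element is.\<close>
      then show ?thesis using gap[OF rs(1,4)] gap[OF rs(2,5)] by auto
    next
      case False
      \<comment> \<open>Otherwise the component in \<open>L\<close> has order dividing two coprime
        numbers, so it is trivial and the first component carries the whole order.\<close>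
      have "L.ord l dvd r * s" "L.ord l dvd q ^ k"
        using dvd[of "r * s"] L.ord_dvd_group_order[OF xl(2)] L(2) n by auto
      moreover have "coprime (r * s) (q ^ k)"
        using False q(1) rs(1,2) by (auto simp: primes_coprime)
      ultimately have "L.ord l = 1"
        using coprime_common_divisor_nat by blast
      then have "B.ord x = r * s"
        using dvd by (metis dvd_antisym dvd_refl one_dvd)
      then have "r + s \<le> n - 1"
        using order_mult_primes_le[OF rs(1-3) xl(1)] by simp
      then show ?thesis by simp
    qed
  qed
qed

text \<open>The two adjacency relations coincide, so the degrees agree without being
  computed.\<close>

lemma degree_pattern_alt_group_DirProd:
  fixes L :: "('a, 'b) monoid_scheme"
  assumes q: "Factorial_Ring.prime q" "odd q" and n: "n = q ^ k" "n > 1"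
    and gap: "\<And>p. Factorial_Ring.prime p \<Longrightarrow> p \<le> n \<Longrightarrow> p + max 4 q < n"
    and L: "group L" "order L = n"
  shows "order (alt_group (n - 1) \<times>\<times> L) = order (alt_group n)"
    and "degree_pattern (alt_group (n - 1) \<times>\<times> L) = degree_pattern (alt_group n)"
proof -
  have n6: "n > 6" using gap[of 2] n(2) by simp
  have "fact n = n * fact (n - 1)" using n6 by (simp add: fact_reduce)
  then have "2 * order (alt_group n) = n * (2 * order (alt_group (n - 1)))"
    using alt_group_card_carrier[of n] alt_group_card_carrier[of "n - 1"] n6 by (simp add: order_def)
  then show ord: "order (alt_group (n - 1) \<times>\<times> L) = order (alt_group n)"
    by (simp add: order_DirProd L(2))
  then have pd: "prime_divisors (alt_group (n - 1) \<times>\<times> L) = prime_divisors (alt_group n)"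
    by (simp add: prime_divisors_def)
  have le: "Factorial_Ring.prime p \<and> p \<le> n" if "p \<in> prime_divisors (alt_group n)" for p
    using that prime_dvd_order_alt_group n6 by (auto simp: prime_divisors_def)
  have "GK_adj (alt_group (n - 1) \<times>\<times> L) r s \<longleftrightarrow> GK_adj (alt_group n) r s" for r s
    unfolding GK_adj_def pd using GK_adj_alt_group_DirProd_iff[OF q n gap L, of r s] le by blast
  then have "GK_degree (alt_group (n - 1) \<times>\<times> L) = GK_degree (alt_group n)"
    unfolding GK_degree_def by presburger
  then show "degree_pattern (alt_group (n - 1) \<times>\<times> L) = degree_pattern (alt_group n)"
    unfolding degree_pattern_def pd by presburger
qed

subsection \<open>A lower bound for the number of classes\<close>

lemma card_le_h_OD:
  fixes K :: "'i \<Rightarrow> ('c, 'd) monoid_scheme"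
  assumes K: "\<And>i. i \<in> I \<Longrightarrow> group (K i)" "\<And>i. i \<in> I \<Longrightarrow> finite (carrier (K i))"
    "\<And>i. i \<in> I \<Longrightarrow> order (K i) = order G" "\<And>i. i \<in> I \<Longrightarrow> degree_pattern (K i) = degree_pattern G"
    and noniso: "\<And>i j. i \<in> I \<Longrightarrow> j \<in> I \<Longrightarrow> K i \<cong> K j \<Longrightarrow> i = j"
    and G: "group G" "finite (carrier G)" "\<And>i. i \<in> I \<Longrightarrow> \<not> G \<cong> K i"
    and I: "finite I"
  shows "Suc (card I) \<le> h_OD G"
proof -
  let ?R = "{(H, K). H \<in> OD_groups G \<and> K \<in> OD_groups G \<and> H \<cong> K}"
  have "\<forall>i\<in>I. \<exists>H\<in>OD_groups G. K i \<cong> H"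
    using OD_groups_complete K by blast
  then obtain H where H: "\<And>i. i \<in> I \<Longrightarrow> H i \<in> OD_groups G" "\<And>i. i \<in> I \<Longrightarrow> K i \<cong> H i"
    by metis
  obtain H0 where H0: "H0 \<in> OD_groups G" "G \<cong> H0"
    using OD_groups_complete[OF G(1,2), of G] by blast
  \<comment> \<open>\<open>None\<close> stands for the class of \<open>G\<close> itself and
    \<open>Some i\<close> for that of \<open>K i\<close>; injectivity of \<open>F\<close> gives the
    count.\<close>
  define F where "F = (\<lambda>i. case i of None \<Rightarrow> ?R `` {H0} | Some i \<Rightarrow> ?R `` {H i})"
  have "?R `` {M} \<in> OD_classes G" if "M \<in> OD_groups G" for M
    unfolding OD_classes_def using that by (rule quotientI)
  then have "F ` (insert None (Some ` I)) \<subseteq> OD_classes G"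
    using H(1) H0(1) by (intro image_subsetI) (auto simp only: F_def option.case)
  moreover have "inj_on F (insert None (Some ` I))"
  proof -
    have iso: "M \<cong> N" if "?R `` {M} = ?R `` {N}" "M \<in> OD_groups G" "N \<in> OD_groups G" for M N
      using eq_equiv_class[OF that(1) equiv_OD that(3)] by blast
    have F: "F None = ?R `` {H0}" "F (Some i) = ?R `` {H i}" for i
      by (simp_all only: F_def option.case)
    have "i = j" if "i \<in> I" "j \<in> I" "F (Some i) = F (Some j)" for i j
    proof -
      have "K i \<cong> H j"
        using H(2)[OF that(1)] iso[OF that(3)[unfolded F]] H(1) that(1,2) iso_trans by blast
      moreover have "H j \<cong> K j" using group.iso_sym[OF K(1)] H(2) that(2) by blast
      ultimately show ?thesis using noniso that(1,2) iso_trans by blast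
    qed
    moreover have "F None \<noteq> F (Some i)" if "i \<in> I" for i
    proof
      assume "F None = F (Some i)"
      then have "G \<cong> H i" unfolding F using H0 iso H(1) that iso_trans by blast
      moreover have "H i \<cong> K i" using group.iso_sym[OF K(1)] H(2) that by blast
      ultimately show False using G(3)[OF that] iso_trans by blast
    qed
    ultimately show ?thesis
      unfolding inj_on_def by (metis imageE insertE)
  qed
  ultimately have "card (insert None (Some ` I)) \<le> h_OD G"
    unfolding h_OD_def by (metis card_inj_on_le finite_OD_classes)
  moreover have "card (insert None (Some ` I)) = Suc (card I)"
    using I by (simp add: card_image)
  ultimately show ?thesis by simp
qed

subsection \<open>The alternating group of degree 625\<close>

text \<open>Four slots accommodate the elementary abelian group; shorter products are padded with
  trivial factors of order 1, so that all of them share one type and form a family.\<close>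

fun cyclic_product :: "nat \<times> nat \<times> nat \<times> nat \<Rightarrow> (int \<times> int \<times> int \<times> int) monoid" where
  "cyclic_product (a, b, c, d) = integer_mod_group a \<times>\<times> integer_mod_group b
     \<times>\<times> integer_mod_group c \<times>\<times> integer_mod_group d"

lemma group_cyclic_product: "group (cyclic_product t)"
  by (cases t) (simp add: DirProd_group)

lemma order_integer_mod_group: "n > 0 \<Longrightarrow> order (integer_mod_group n) = n"
  by (simp add: order_def carrier_integer_mod_group)

text \<open>The entries are powers of 5 whose exponents run through the five partitions of 4, padded
  with zeros.\<close>

definition abelian_types_625 :: "(nat \<times> nat \<times> nat \<times> nat) set" where
  "abelian_types_625 = {(625, 1, 1, 1), (125, 5, 1, 1), (25, 25, 1, 1), (25, 5, 5, 1), (5, 5, 5, 5)}"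

lemma order_cyclic_product:
  assumes "t \<in> abelian_types_625"
  shows "order (cyclic_product t) = 625"
  using assms by (auto simp: abelian_types_625_def order_DirProd order_integer_mod_group)

lemma gcd_powers_5: "gcd 5 (625::nat) = 5" "gcd 5 (125::nat) = 5" "gcd 5 (25::nat) = 5"
  "gcd 25 (625::nat) = 25" "gcd 25 (125::nat) = 25" "gcd 25 (5::nat) = 5"
  by (simp_all add: gcd_nat.absorb1 gcd_nat.absorb2)

text \<open>In the listed order the pairs are (5, 25), (25, 125), (25, 625), (125, 625) and (625,
  625). Exponent 25 separates the second type from the third, which exponent 5 cannot.\<close>

lemma inj_on_card_pow_eq_one:
  "inj_on (\<lambda>t. (card_pow_eq_one 5 (cyclic_product t), card_pow_eq_one 25 (cyclic_product t)))
    abelian_types_625"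
  by (simp add: abelian_types_625_def card_pow_eq_one_DirProd card_pow_eq_one_integer_mod_group gcd_powers_5)

lemma prime_le_625_gap:
  fixes p :: nat
  assumes "Factorial_Ring.prime p" "p \<le> 625"
  shows "p + max 4 5 < 625"
proof (rule ccontr)
  assume "\<not> ?thesis"
  then have "p \<in> {620, 621, 622, 623, 624, 625}" using assms(2) by auto
  moreover have "\<not> d dvd p" if "1 < d" "d < p" for d
    using assms(1) that by (auto simp: prime_nat_iff)
  \<comment> \<open>These four divisors rule out all six candidates; 7 is there for
    \<open>623 = 7 * 89\<close>.\<close>
  from this[of 2] this[of 3] this[of 5] this[of 7]
  have "p > 7 \<Longrightarrow> \<not> 2 dvd p \<and> \<not> 3 dvd p \<and> \<not> 5 dvd p \<and> \<not> 7 dvd p" by simp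
  ultimately show False by auto
qed

lemma six_le_h_OD_alt_group_625: "6 \<le> h_OD (alt_group 625)"
proof -
  let ?K = "\<lambda>t. alt_group 624 \<times>\<times> cyclic_product t"
  have gK: "group (?K t)" for t
    by (intro DirProd_group alt_group_is_group group_cyclic_product)
  have "625 = (5::nat) ^ 4" by simp
  then have pattern: "order (?K t) = order (alt_group 625)"
      "degree_pattern (?K t) = degree_pattern (alt_group 625)" if "t \<in> abelian_types_625" for t
    using degree_pattern_alt_group_DirProd[of 5 625 4 "cyclic_product t"]
      prime_le_625_gap order_cyclic_product[OF that] group_cyclic_product[of t] by simp_all
  \<comment> \<open>An infinite carrier would have order 0, so finiteness of the products follows
    from the equality of orders.\<close>
  have "order (alt_group n) > 0" for n
    using finite_alt_group monoid.order_gt_0_iff_finite[OF group.is_monoid[OF alt_group_is_group]] by blast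
  then have fin: "finite (carrier (?K t))" if "t \<in> abelian_types_625" for t
    using pattern(1)[OF that] monoid.order_gt_0_iff_finite[OF group.is_monoid[OF gK]] by metis
  \<comment> \<open>Nonzero counts allow the common factor of degree 624 to be cancelled from the
    multiplicative invariant.\<close>
  have pos: "card_pow_eq_one k (alt_group 624) \<noteq> 0" for k
    using card_pow_eq_one_pos[OF alt_group_is_group finite_alt_group] by (metis not_gr_zero)
  have "Suc (card abelian_types_625) \<le> h_OD (alt_group 625)"
  proof (rule card_le_h_OD[where K = ?K])
    fix t u assume "t \<in> abelian_types_625" "u \<in> abelian_types_625" "?K t \<cong> ?K u"
    then have "card_pow_eq_one k (cyclic_product t) = card_pow_eq_one k (cyclic_product u)" for k
      using card_pow_eq_one_iso[OF gK gK, of t u k] pos by (simp add: card_pow_eq_one_DirProd)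
    then show "t = u"
      using inj_on_card_pow_eq_one \<open>t \<in> _\<close> \<open>u \<in> _\<close> by (auto dest: inj_onD)
  next
    fix t assume t: "t \<in> abelian_types_625"
    have "order (alt_group 624) > 1"
      using simple_group.order_gt_one[OF simple_alt_group] by simp
    then have "\<not> simple_group (?K t)"
      using order_cyclic_product[OF t]
      by (intro not_simple_DirProd alt_group_is_group group_cyclic_product) simp_all
    then show "\<not> alt_group 625 \<cong> ?K t"
      using simple_group.iso_simple[OF simple_alt_group[of 625] gK[of t]] by (auto simp: is_iso_def)
  qed (use gK fin pattern alt_group_is_group finite_alt_group in \<open>simp_all add: abelian_types_625_def\<close>)
  then show ?thesis by (simp add: abelian_types_625_def)
qed

theorem corollary1p9:
  shows "h_OD (alt_group 625) \<ge> 6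
    \<and> (finite (carrier (alt_group 625)) \<and> simple_group (alt_group 625)
        \<and> (\<exists>k\<ge>3. fold_OD_characterizable k (alt_group 625)))
    \<and> \<not> (\<forall>m. m \<noteq> 10 \<longrightarrow> OD_characterizable (alt_group m))"
proof -
  have six: "h_OD (alt_group 625) \<ge> 6" by (rule six_le_h_OD_alt_group_625)
  \<comment> \<open>The witness is \<open>h_OD (alt_group 625)\<close> itself.\<close>
  then have "\<exists>k\<ge>3. fold_OD_characterizable k (alt_group 625)"
    by (auto simp: fold_OD_characterizable_def)
  moreover have "\<not> OD_characterizable (alt_group 625)"
    using six by (simp add: OD_characterizable_def)
  ultimately show ?thesis
    using six finite_alt_group[of 625] simple_alt_group[of 625]
    by (auto intro!: exI[of _ "625::nat"])
qed

end
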